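(* Let $q$ be a prime power, let $G=\mathrm{GL}_2(\mathbb{F}_q)$ or $G=\mathrm{SL}_2(\mathbb{F}_q)$, and let $U=\left\{\begin{pmatrix}1&x\\0&1\end{pmatrix}: x\in\mathbb{F}_q\right\}$ be the subgroup of $G$ consisting of upper-triangular unipotent matrices. Then the action of $G$ on $G/U$ has the strong EKR property.
   Context: Let a finite group $G$ act transitively on a finite set $X$. A subset $S\subseteq G$ is called intersecting (for this action) if for all $g,h\in S$ there exists $x\in X$ with $g\cdot x=h\cdot x$. The action has the weak EKR property if every intersecting set $S\subseteq G$ satisfies $|S|\le |G|/|X|$ (the cardinality of a point stabilizer). The action has the strong EKR property if it has the weak EKR property and, in addition, the only intersecting sets of size $|G|/|X|$ are the cosets of point stabilizers. For a subgroup $H\le G$, the action of $G$ on $G/H$ is by left translation: $g\cdot(xH)=(gx)H$; its point stabilizers are the conjugates of $H$. $\mathbb{F}_q$ is the finite field with $q$ elements. *)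

theory Defs
  imports
    "HOL-Analysis.Analysis"
    "HOL-Number_Theory.Prime_Powers"
    "HOL-Algebra.Group_Action"
    "HOL-Algebra.Left_Coset"
begin

section \<open>Erdos-Ko-Rado properties of group actions\<close>

text \<open>These notions are meant for a transitive action \<open>\<phi>\<close> of a finite group \<open>G\<close> on a finite set
  \<open>X\<close>, i.e. for \<^prop>\<open>transitive_action G X \<phi>\<close> with finite carriers.\<close>

definition intersecting ::
  "('g, 'm) monoid_scheme \<Rightarrow> 'x set \<Rightarrow> ('g \<Rightarrow> 'x \<Rightarrow> 'x) \<Rightarrow> 'g set \<Rightarrow> bool" where
  "intersecting G X \<phi> S \<longleftrightarrow>
     S \<subseteq> carrier G \<and> (\<forall>g\<in>S. \<forall>h\<in>S. \<exists>x\<in>X. \<phi> g x = \<phi> h x)"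

definition weak_EKR ::
  "('g, 'm) monoid_scheme \<Rightarrow> 'x set \<Rightarrow> ('g \<Rightarrow> 'x \<Rightarrow> 'x) \<Rightarrow> bool" where
  "weak_EKR G X \<phi> \<longleftrightarrow>
     (\<forall>S. intersecting G X \<phi> S \<longrightarrow> real (card S) \<le> real (card (carrier G)) / real (card X))"

text \<open>Only left cosets are mentioned below. If \<open>H\<close> is the stabilizer of \<open>x\<close>, then
  \<open>gH = (gHg\<^sup>-\<^sup>1)g\<close> and \<open>gHg\<^sup>-\<^sup>1\<close> is the stabilizer of \<open>g \<cdot> x\<close>, so the right cosets of point
  stabilizers form the same family of sets.\<close>

definition strong_EKR ::
  "('g, 'm) monoid_scheme \<Rightarrow> 'x set \<Rightarrow> ('g \<Rightarrow> 'x \<Rightarrow> 'x) \<Rightarrow> bool" where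
  "strong_EKR G X \<phi> \<longleftrightarrow>
     weak_EKR G X \<phi> \<and>
     (\<forall>S. intersecting G X \<phi> S \<and> real (card S) = real (card (carrier G)) / real (card X) \<longleftrightarrow>
          (\<exists>x\<in>X. \<exists>g\<in>carrier G. S = g <#\<^bsub>G\<^esub> stabilizer G \<phi> x))"

section \<open>Left translation on cosets\<close>

text \<open>The restriction to the coset space is needed because \<^const>\<open>BijGroup\<close>, and hence
  \<^const>\<open>group_action\<close>, only admits extensional functions.\<close>

definition coset_action ::
  "('g, 'm) monoid_scheme \<Rightarrow> 'g set \<Rightarrow> 'g \<Rightarrow> 'g set \<Rightarrow> 'g set" where
  "coset_action G H = (\<lambda>g. \<lambda>C\<in>lcosets\<^bsub>G\<^esub> H. g <#\<^bsub>G\<^esub> C)"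

lemma (in group) transitive_action_coset_action:
  assumes "subgroup H G"
  shows "transitive_action G (lcosets H) (coset_action G H)"
proof -
  interpret H: subgroup H G by fact
  have mem: "g <# C \<in> lcosets H" if "g \<in> carrier G" "C \<in> lcosets H" for g C
    using that by (auto simp: LCOSETS_def lcos_m_assoc[OF H.subset])
  have sub: "C \<subseteq> carrier G" if "C \<in> lcosets H" for C
    using that H.lcosets_carrier[OF is_group] by blast
  have inv: "inv g <# (g <# C) = C" "g <# (inv g <# C) = C"
    if "g \<in> carrier G" "C \<in> lcosets H" for g C
    using that sub[of C] by (simp_all add: lcos_m_assoc lcos_mult_one)
  have bij: "coset_action G H g \<in> Bij (lcosets H)" if g: "g \<in> carrier G" for g
  proof -
    have "bij_betw (coset_action G H g) (lcosets H) (lcosets H)"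
      by (rule bij_betw_byWitness[where f' = "coset_action G H (inv g)"])
        (use g in \<open>auto simp: coset_action_def mem inv\<close>)
    then show ?thesis
      by (simp add: Bij_def coset_action_def)
  qed
  have "coset_action G H \<in> hom G (BijGroup (lcosets H))"
  proof (rule homI)
    show "coset_action G H g \<in> carrier (BijGroup (lcosets H))" if "g \<in> carrier G" for g
      using bij[OF that] by (simp add: BijGroup_def)
    show "coset_action G H (g \<otimes> h) =
        coset_action G H g \<otimes>\<^bsub>BijGroup (lcosets H)\<^esub> coset_action G H h"
      if "g \<in> carrier G" "h \<in> carrier G" for g h
      using that bij[of g] bij[of h] sub
      by (auto simp: BijGroup_def compose_def coset_action_def fun_eq_iff restrict_def mem
          lcos_m_assoc)
  qed
  then have "group_action G (lcosets H) (coset_action G H)"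
    by (simp add: group_action_def group_hom_def group_hom_axioms_def is_group group_BijGroup)
  moreover have "\<exists>g\<in>carrier G. coset_action G H g C = D"
    if CD: "C \<in> lcosets H" "D \<in> lcosets H" for C D
  proof -
    obtain a b where ab: "a \<in> carrier G" "C = a <# H" "b \<in> carrier G" "D = b <# H"
      using CD by (auto simp: LCOSETS_def)
    then have "coset_action G H (b \<otimes> inv a) C = D"
      using CD by (simp add: coset_action_def lcos_m_assoc H.subset m_assoc)
    with ab show ?thesis by blast
  qed
  ultimately show ?thesis
    by (simp add: transitive_action_def transitive_action_axioms_def)
qed

section \<open>The groups\<close>

definition GL2 :: "('a::field ^ 2 ^ 2) monoid" where
  "GL2 = \<lparr>carrier = {A. invertible A}, mult = (**), one = mat 1\<rparr>"

definition SL2 :: "('a::field ^ 2 ^ 2) monoid" where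
  "SL2 = \<lparr>carrier = {A. det A = 1}, mult = (**), one = mat 1\<rparr>"

definition unipotent_upper :: "('a::field ^ 2 ^ 2) set" where
  "unipotent_upper = {vector [vector [1, x], vector [0, 1]] | x. True}"

lemma group_GL2: "group (GL2 :: ('a::field ^ 2 ^ 2) monoid)"
proof (rule groupI)
  fix A :: "'a ^ 2 ^ 2"
  assume "A \<in> carrier GL2"
  then obtain B where "A ** B = mat 1" "B ** A = mat 1"
    by (auto simp: GL2_def invertible_def)
  then show "\<exists>B\<in>carrier GL2. B \<otimes>\<^bsub>GL2\<^esub> A = \<one>\<^bsub>GL2\<^esub>"
    by (auto simp: GL2_def invertible_def)
qed (auto simp: GL2_def invertible_mult matrix_mul_assoc invertible_def[of "mat 1"])

lemma subgroup_SL2_GL2: "subgroup (carrier SL2) (GL2 :: ('a::field ^ 2 ^ 2) monoid)"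
proof -
  interpret group "GL2 :: ('a ^ 2 ^ 2) monoid" by (rule group_GL2)
  show ?thesis
  proof (rule subgroupI)
    show "carrier SL2 \<subseteq> carrier (GL2 :: ('a ^ 2 ^ 2) monoid)"
      by (auto simp: GL2_def SL2_def invertible_det_nz)
    show "carrier SL2 \<noteq> ({} :: ('a ^ 2 ^ 2) set)"
      by (auto simp: SL2_def intro: exI[of _ "mat 1"])
    fix A :: "'a ^ 2 ^ 2"
    assume A: "A \<in> carrier SL2"
    then have A': "A \<in> carrier GL2"
      by (auto simp: GL2_def SL2_def invertible_det_nz)
    have "inv\<^bsub>GL2\<^esub> A ** A = mat 1"
      using l_inv[OF A'] by (simp add: GL2_def)
    then have "det (inv\<^bsub>GL2\<^esub> A) * det A = 1"
      by (metis det_I det_mul)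
    then show "inv\<^bsub>GL2\<^esub> A \<in> carrier SL2"
      using A by (simp add: SL2_def)
  next
    fix A B :: "'a ^ 2 ^ 2"
    assume "A \<in> carrier SL2" "B \<in> carrier SL2"
    then show "A \<otimes>\<^bsub>GL2\<^esub> B \<in> carrier SL2"
      by (simp add: GL2_def SL2_def det_mul)
  qed
qed

lemma group_SL2: "group (SL2 :: ('a::field ^ 2 ^ 2) monoid)"
proof -
  have "SL2 = (GL2 :: ('a ^ 2 ^ 2) monoid)\<lparr>carrier := carrier SL2\<rparr>"
    by (simp add: GL2_def SL2_def)
  then show ?thesis
    using subgroup.subgroup_is_group[OF subgroup_SL2_GL2 group_GL2] by metis
qed

lemma unipotent_upper_mult:
  fixes x y :: "'a::field"
  shows "(vector [vector [1, x], vector [0, 1]] :: 'a ^ 2 ^ 2) ** vector [vector [1, y], vector [0, 1]] =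
    (vector [vector [1, x + y], vector [0, 1]] :: 'a ^ 2 ^ 2)"
  by (simp add: vec_eq_iff forall_2 matrix_matrix_mult_def UNIV_2 add.commute)

lemma unipotent_upper_one: "vector [vector [1, 0], vector [0, 1]] = (mat 1 :: 'a::field ^ 2 ^ 2)"
  by (simp add: vec_eq_iff forall_2 mat_def)

lemma subgroup_unipotent_upper:
  fixes G :: "('a::field ^ 2 ^ 2) monoid"
  assumes "G \<in> {GL2, SL2}"
  shows "subgroup unipotent_upper G"
proof -
  interpret group G using assms group_GL2 group_SL2 by blast
  have mult: "A \<otimes>\<^bsub>G\<^esub> B = A ** B" and one: "\<one>\<^bsub>G\<^esub> = mat 1" for A B
    using assms by (auto simp: GL2_def SL2_def)
  have "unipotent_upper \<subseteq> (carrier SL2 :: ('a ^ 2 ^ 2) set)"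
    by (auto simp: unipotent_upper_def SL2_def det_2)
  then have sub: "unipotent_upper \<subseteq> carrier G"
    using assms subgroup.subset[OF subgroup_SL2_GL2] by blast
  show ?thesis
  proof (rule subgroupI)
    fix A assume A: "A \<in> (unipotent_upper :: ('a ^ 2 ^ 2) set)"
    then obtain x where x: "A = vector [vector [1, x], vector [0, 1]]"
      by (auto simp: unipotent_upper_def)
    define B :: "'a ^ 2 ^ 2" where "B = vector [vector [1, - x], vector [0, 1]]"
    have B: "B \<in> unipotent_upper"
      by (auto simp: unipotent_upper_def B_def)
    have "B \<otimes>\<^bsub>G\<^esub> A = \<one>\<^bsub>G\<^esub>"
      by (simp add: mult one x B_def unipotent_upper_mult unipotent_upper_one)
    then have "inv\<^bsub>G\<^esub> A = B"
      using A B sub by (intro inv_equality) auto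
    with B show "inv\<^bsub>G\<^esub> A \<in> unipotent_upper" by simp
  qed (use sub in \<open>auto simp: unipotent_upper_def mult unipotent_upper_mult\<close>)
qed

end

theory Submission
  imports Defs
begin

text \<open>If \<open>g\<close> and \<open>h\<close> agree on a coset of \<open>U\<close>, then \<open>g\<inverse>h\<close> is conjugate to an element of \<open>U\<close>, and so
  has determinant 1 and trace 2. Given an intersecting set \<open>S\<close> with two distinct elements \<open>g\<close>, \<open>h\<close>,
  translate by \<open>g\<inverse>\<close> and conjugate so that \<open>1 \<in> S\<close> and \<open>1 \<noteq> u \<in> S\<close> with \<open>u \<in> U\<close>. Any \<open>t \<in> S\<close> then
  satisfies \<open>det t = 1\<close> and \<open>tr t = tr (u\<inverse>t) = 2\<close>. The last two equations force the lower left entry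
  of \<open>t\<close> to vanish, and then both diagonal entries are 1, i.e. \<open>t \<in> U\<close>. Hence every nonempty
  intersecting set lies in a coset of a point stabilizer, which gives both EKR properties at once.\<close>

lemma (in group_action) mem_l_coset_stabilizer:
  assumes "x \<in> E" "g \<in> carrier G" "h \<in> carrier G" "\<phi> h x = \<phi> g x"
  shows "h \<in> g <# stabilizer G \<phi> x"
proof -
  interpret group G using group_hom group_hom.axioms(1) by blast
  have "\<phi> (inv g \<otimes> h) x = x"
    using assms orbit_sym_aux[of g x "\<phi> g x"] by (simp add: composition_rule)
  then have "inv g \<otimes> h \<in> stabilizer G \<phi> x"
    using assms by (simp add: stabilizer_def)
  moreover have "h = g \<otimes> (inv g \<otimes> h)"
    using assms by (simp flip: m_assoc)
  ultimately show ?thesis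
    unfolding l_coset_def by blast
qed

text \<open>Every element of the coset sends \<open>x\<close> to \<open>\<phi> g x\<close>, so the
  single point \<open>x\<close> witnesses all pairwise agreements.\<close>

lemma (in group_action) intersecting_l_coset_stabilizer:
  assumes "x \<in> E" "g \<in> carrier G"
  shows "intersecting G E \<phi> (g <# stabilizer G \<phi> x)"
proof -
  interpret group G using group_hom group_hom.axioms(1) by blast
  have "\<phi> h x = \<phi> g x" if "h \<in> g <# stabilizer G \<phi> x" for h
    using that assms by (auto simp: l_coset_def stabilizer_def composition_rule)
  moreover have "g <# stabilizer G \<phi> x \<subseteq> carrier G"
    by (rule l_coset_subset_G) (use assms stabilizer_subset in auto)
  ultimately show ?thesis
    using assms(1) unfolding intersecting_def by metis
qed

lemma (in transitive_action) card_l_coset_stabilizer: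
  assumes "finite (carrier G)" "x \<in> E" "g \<in> carrier G"
  shows "real (card (g <# stabilizer G \<phi> x)) = real (card (carrier G)) / real (card E)"
proof -
  interpret group G using group_hom group_hom.axioms(1) by blast
  have orb: "orbit G \<phi> x = E"
    using assms(2) unique_orbit element_image unfolding orbit_def by fastforce
  moreover have "orbit G \<phi> x = (\<lambda>g. \<phi> g x) ` carrier G"
    by (auto simp: orbit_def)
  \<comment> \<open>\<open>E\<close> is an image of the finite carrier, hence finite, and it
    contains \<open>x\<close>. This makes the division by \<open>card E\<close> below
    legitimate.\<close>
  ultimately have "card E \<noteq> 0"
    using assms by (metis card_eq_0_iff empty_iff finite_imageI)
  moreover have "card E * card (stabilizer G \<phi> x) = card (carrier G)"
    using orbit_stabilizer_theorem[OF assms(2)] orb by (simp add: order_def)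
  moreover have "card (g <# stabilizer G \<phi> x) = card (stabilizer G \<phi> x)"
  proof -
    have "g <# stabilizer G \<phi> x \<in> lcosets (stabilizer G \<phi> x)"
      using assms(3) unfolding LCOSETS_def by blast
    then show ?thesis
      using l_card_cosets_equal[OF _ stabilizer_subset assms(1)] by metis
  qed
  ultimately show ?thesis
    by (metis nonzero_mult_div_cancel_left of_nat_eq_0_iff of_nat_mult)
qed

text \<open>All cosets of point stabilizers have size |G|/|E|. Containment in one of them therefore
  gives the weak bound, and a set attaining the bound must fill the whole finite coset.\<close>

lemma (in transitive_action) strong_EKR_if_subset_l_coset_stabilizer:
  assumes fin: "finite (carrier G)" and "E \<noteq> {}"
    and sub: "\<And>S. intersecting G E \<phi> S \<Longrightarrow> S \<noteq> {} \<Longrightarrow>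
      \<exists>x\<in>E. \<exists>g\<in>carrier G. S \<subseteq> g <# stabilizer G \<phi> x"
  shows "strong_EKR G E \<phi>"
proof -
  interpret group G using group_hom group_hom.axioms(1) by blast
  have fin_coset: "finite (g <# stabilizer G \<phi> x)" if "g \<in> carrier G" for g x
    using fin that by (meson finite_subset l_coset_subset_G stabilizer_subset)
  obtain x where x: "x \<in> E" using \<open>E \<noteq> {}\<close> by blast
  have "\<one> \<in> \<one> <# stabilizer G \<phi> x"
    using x by (intro mem_l_coset_stabilizer) auto
  then have "card (\<one> <# stabilizer G \<phi> x) \<noteq> 0"
    using fin_coset by auto
  \<comment> \<open>Positivity handles the empty set, to which \<open>sub\<close> does not apply: it
    satisfies the bound and never attains it.\<close>
  then have pos: "real (card (carrier G)) / real (card E) > 0"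
    using card_l_coset_stabilizer[OF fin x one_closed] by linarith
  have "weak_EKR G E \<phi>"
    unfolding weak_EKR_def
  proof (intro allI impI)
    fix S assume S: "intersecting G E \<phi> S"
    show "real (card S) \<le> real (card (carrier G)) / real (card E)"
    proof (cases "S = {}")
      case True
      with pos show ?thesis by simp
    next
      case False
      with sub[OF S] obtain y g
        where y: "y \<in> E" "g \<in> carrier G" "S \<subseteq> g <# stabilizer G \<phi> y" by blast
      then show ?thesis
        using card_mono[OF fin_coset y(3)] card_l_coset_stabilizer[OF fin] by fastforce
    qed
  qed
  moreover have "\<exists>y\<in>E. \<exists>g\<in>carrier G. S = g <# stabilizer G \<phi> y"
    if S: "intersecting G E \<phi> S" "real (card S) = real (card (carrier G)) / real (card E)" for S
  proof -
    have "S \<noteq> {}" using S(2) pos by auto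
    with sub[OF S(1)] obtain y g
      where y: "y \<in> E" "g \<in> carrier G" "S \<subseteq> g <# stabilizer G \<phi> y" by blast
    moreover have "card S = card (g <# stabilizer G \<phi> y)"
      using S(2) card_l_coset_stabilizer[OF fin y(1,2)] by simp
    ultimately show ?thesis
      using card_subset_eq[OF fin_coset] by blast
  qed
  ultimately show ?thesis
    unfolding strong_EKR_def
    using intersecting_l_coset_stabilizer card_l_coset_stabilizer[OF fin] by blast
qed

lemma (in group) coset_action_eq_imp_conj:
  assumes H: "subgroup H G" and g: "g \<in> carrier G" "h \<in> carrier G"
    and x: "x \<in> lcosets H" "coset_action G H g x = coset_action G H h x"
  obtains k where "k \<in> carrier G" "x = k <# H" "inv k \<otimes> (inv g \<otimes> h) \<otimes> k \<in> H"
proof -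
  interpret H: subgroup H G by (rule H)
  obtain k where k: "k \<in> carrier G" "x = k <# H"
    using x(1) by (auto simp: LCOSETS_def)
  have "(g \<otimes> k) <# H = (h \<otimes> k) <# H"
    using x g k by (simp add: coset_action_def lcos_m_assoc H.subset)
  then have "h \<otimes> k \<in> (g \<otimes> k) <# H"
    using lcos_self[OF _ H, of "h \<otimes> k"] g k by simp
  then have "inv (g \<otimes> k) \<otimes> (h \<otimes> k) \<in> H"
    using g k H.lcos_module_imp[OF is_group] by simp
  then show thesis
    using that[OF k] g k by (simp add: inv_mult_group m_assoc)
qed

text \<open>The assumption \<open>conj\<close> isolates what must be checked in a concrete group;
  translation and conjugation of an intersecting set are carried out here for an arbitrary
  subgroup.\<close>

lemma (in group) strong_EKR_coset_action:
  assumes fin: "finite (carrier G)" and H: "subgroup H G"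
    and conj: "\<And>u t k l. \<lbrakk>u \<in> H; u \<noteq> \<one>; t \<in> carrier G; k \<in> carrier G; l \<in> carrier G;
      inv k \<otimes> t \<otimes> k \<in> H; inv l \<otimes> (inv u \<otimes> t) \<otimes> l \<in> H\<rbrakk> \<Longrightarrow> t \<in> H"
  shows "strong_EKR G (lcosets H) (coset_action G H)"
proof -
  interpret H: subgroup H G by (rule H)
  interpret transitive_action G "lcosets H" "coset_action G H"
    by (rule transitive_action_coset_action[OF H])
  show ?thesis
  proof (rule strong_EKR_if_subset_l_coset_stabilizer[OF fin])
    show "lcosets H \<noteq> {}"
      by (auto simp: LCOSETS_def)
    fix S assume S: "intersecting G (lcosets H) (coset_action G H) S" and "S \<noteq> {}"
    from \<open>S \<noteq> {}\<close> obtain g where g: "g \<in> S" by blast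
    have S_sub: "S \<subseteq> carrier G"
      using S by (simp add: intersecting_def)
    have conj_in_H: "\<exists>k\<in>carrier G. inv k \<otimes> (inv a \<otimes> b) \<otimes> k \<in> H" if ab: "a \<in> S" "b \<in> S" for a b
    proof -
      obtain x where x: "x \<in> lcosets H" "coset_action G H a x = coset_action G H b x"
        using S ab unfolding intersecting_def by blast
      have "a \<in> carrier G" "b \<in> carrier G" using ab S_sub by auto
      from coset_action_eq_imp_conj[OF H this x] show ?thesis by blast
    qed
    have "\<exists>x\<in>lcosets H. S \<subseteq> g <# stabilizer G (coset_action G H) x"
    \<comment> \<open>A singleton lies in a coset of any point stabilizer; the coset
      \<open>H\<close> itself serves as the point.\<close>
    proof (cases "S = {g}")
      case True
      have "\<one> <# H \<in> lcosets H"
        unfolding LCOSETS_def by blast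
      moreover have "g \<in> carrier G" using g S_sub by blast
      ultimately show ?thesis
        using True mem_l_coset_stabilizer by blast
    next
      case False
      with g obtain h where h: "h \<in> S" "h \<noteq> g" by blast
      have carr: "g \<in> carrier G" "h \<in> carrier G" using g h S_sub by auto
      \<comment> \<open>The conjugator \<open>k\<close> is fixed once for the pair \<open>g\<close>,
        \<open>h\<close>; all of \<open>S\<close> will be shown to agree with \<open>g\<close> at
        the point \<open>k <# H\<close>.\<close>
      obtain k where k: "k \<in> carrier G" "inv k \<otimes> (inv g \<otimes> h) \<otimes> k \<in> H" (is "?u \<in> H")
        using conj_in_H[OF g h(1)] by blast
      have "?u \<noteq> \<one>"
      proof
        assume "?u = \<one>"
        then have "inv k \<otimes> (inv g \<otimes> h) = inv k \<otimes> \<one>"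
          using k carr by (metis inv_closed inv_equality inv_inv m_closed r_one)
        then have "inv g \<otimes> h = \<one>"
          using k carr by simp
        then show False using h(2) carr by (metis inv_closed inv_equality inv_inv)
      qed
      have "s \<in> g <# stabilizer G (coset_action G H) (k <# H)" if s: "s \<in> S" for s
      proof -
        \<comment> \<open>\<open>?t\<close> is \<open>s\<close> after the normalization that turns
          \<open>g\<close> into \<open>\<one>\<close> and \<open>h\<close> into
          \<open>?u\<close>.\<close>
        let ?t = "inv k \<otimes> (inv g \<otimes> s) \<otimes> k"
        have s': "s \<in> carrier G" using s S_sub by auto
        obtain l where l: "l \<in> carrier G" "inv l \<otimes> (inv g \<otimes> s) \<otimes> l \<in> H"
          using conj_in_H[OF g s] by blast
        obtain m where m: "m \<in> carrier G" "inv m \<otimes> (inv h \<otimes> s) \<otimes> m \<in> H"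
          using conj_in_H[OF h(1) s] by blast
        have cancel: "k \<otimes> (inv k \<otimes> a) = a" "g \<otimes> (inv g \<otimes> a) = a" if "a \<in> carrier G" for a
          using that k carr by (simp_all flip: m_assoc)
        have "?t \<in> H"
        proof (rule conj[OF k(2) \<open>?u \<noteq> \<one>\<close>])
          \<comment> \<open>The factor \<open>inv k\<close> in both conjugators undoes the
            normalization. In the second goal \<open>g\<close> cancels, since
            \<open>inv ?u \<otimes> ?t\<close> equals
            \<open>inv k \<otimes> (inv h \<otimes> s) \<otimes> k\<close>.\<close>
          show "inv (inv k \<otimes> l) \<otimes> ?t \<otimes> (inv k \<otimes> l) \<in> H"
            using l k carr s' by (simp add: inv_mult_group m_assoc cancel)
          show "inv (inv k \<otimes> m) \<otimes> (inv ?u \<otimes> ?t) \<otimes> (inv k \<otimes> m) \<in> H"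
            using m k carr s' by (simp add: inv_mult_group m_assoc cancel)
        qed (use k l m carr s' in auto)
        \<comment> \<open>This is \<open>?t\<close> regrouped; it says that \<open>s\<close> and
          \<open>g\<close> move \<open>k <# H\<close> to the same coset.\<close>
        then have "inv (g \<otimes> k) \<otimes> (s \<otimes> k) \<in> H"
          using k carr s' by (simp add: inv_mult_group m_assoc)
        then have "s \<otimes> k \<in> (g \<otimes> k) <# H"
          using k carr s' H.lcos_module_rev[OF is_group] by simp
        then have "(g \<otimes> k) <# H = (s \<otimes> k) <# H"
          using k carr by (intro l_repr_independence[OF _ _ H]) auto
        moreover have "k <# H \<in> lcosets H"
          using k by (auto simp: LCOSETS_def)
        ultimately show ?thesis
          using k carr s'
          by (intro mem_l_coset_stabilizer) (auto simp: coset_action_def lcos_m_assoc H.subset)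
      qed
      then show ?thesis
        using k by (auto simp: LCOSETS_def)
    qed
    then show "\<exists>x\<in>lcosets H. \<exists>g\<in>carrier G. S \<subseteq> g <# stabilizer G (coset_action G H) x"
      using g S_sub by blast
  qed
qed

lemma trace_det_unipotent_upper:
  assumes "u \<in> (unipotent_upper :: ('a::field ^ 2 ^ 2) set)"
  shows "trace u = 2" "det u = 1"
  using assms by (auto simp: unipotent_upper_def trace_def det_2 UNIV_2)

text \<open>Multiplying by the unipotent matrix adds \<open>x * t$2$1\<close> to the trace, so equal
  traces kill the lower left entry.\<close>

lemma unipotent_upper_if_trace:
  fixes t :: "'a::field ^ 2 ^ 2"
  assumes "x \<noteq> 0" "trace t = 2" "det t = 1"
    and "trace (vector [vector [1, x], vector [0, 1]] ** t) = 2"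
  shows "t \<in> unipotent_upper"
proof -
  have tr: "t$1$1 + t$2$2 = 2"
    using assms(2) by (simp add: trace_def UNIV_2)
  have "t$1$1 + x * t$2$1 + t$2$2 = 2"
    using assms(4) by (simp add: trace_def UNIV_2 matrix_matrix_mult_def)
  then have "x * t$2$1 = 2 - (t$1$1 + t$2$2)" by (simp add: algebra_simps)
  then have "x * t$2$1 = 0" using tr by simp
  with \<open>x \<noteq> 0\<close> have c: "t$2$1 = 0" by simp
  with assms(3) have "t$1$1 * t$2$2 = 1" by (simp add: det_2)
  moreover have "t$2$2 = 2 - t$1$1"
    using tr by (simp add: algebra_simps)
  \<comment> \<open>The diagonal entries have sum 2 and product 1; eliminating one leaves a perfect
    square, in characteristic 2 as well.\<close>
  ultimately have "(t$1$1 - 1)\<^sup>2 = 0"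
    by (simp add: power2_eq_square algebra_simps)
  then have "t$1$1 = 1" by simp
  with tr c have "t = vector [vector [1, t$1$2], vector [0, 1]]"
    by (simp add: vec_eq_iff forall_2)
  then show ?thesis
    unfolding unipotent_upper_def by blast
qed

theorem theorem5:
  fixes q :: nat
    and G :: "('a::{field,finite} ^ 2 ^ 2) monoid"
  assumes "primepow q"
    and "CARD('a) = q"
    and "G \<in> {GL2, SL2}"
  shows "strong_EKR G (lcosets\<^bsub>G\<^esub> unipotent_upper) (coset_action G unipotent_upper)"
proof -
  interpret group G using assms(3) group_GL2 group_SL2 by blast
  have sub: "subgroup unipotent_upper G"
    by (rule subgroup_unipotent_upper[OF assms(3)])
  interpret U: subgroup unipotent_upper G by (rule sub)
  have mult: "A \<otimes>\<^bsub>G\<^esub> B = A ** B" and one: "\<one>\<^bsub>G\<^esub> = mat 1" for A B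
    using assms(3) by (auto simp: GL2_def SL2_def)
  \<comment> \<open>Trace and determinant are invariant under conjugation, so they can be read off
    from the conjugate in \<open>unipotent_upper\<close>.\<close>
  have trace_det: "trace t = 2" "det t = 1"
    if t: "t \<in> carrier G" "k \<in> carrier G" "inv\<^bsub>G\<^esub> k \<otimes>\<^bsub>G\<^esub> t \<otimes>\<^bsub>G\<^esub> k \<in> unipotent_upper" for t k
  proof -
    have k: "k ** inv\<^bsub>G\<^esub> k = mat 1"
      using r_inv[OF t(2)] by (simp add: mult one)
    have "trace (inv\<^bsub>G\<^esub> k ** t ** k) = trace (k ** inv\<^bsub>G\<^esub> k ** t)"
      by (metis matrix_mul_assoc trace_mul_sym)
    then show "trace t = 2"
      using k trace_det_unipotent_upper(1)[OF t(3)] by (simp add: mult)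
    have "det (inv\<^bsub>G\<^esub> k ** t ** k) = det (k ** inv\<^bsub>G\<^esub> k) * det t"
      by (simp add: det_mul)
    then show "det t = 1"
      using k trace_det_unipotent_upper(2)[OF t(3)] by (simp add: mult)
  qed
  show ?thesis
  proof (rule strong_EKR_coset_action[OF _ sub])
    show "finite (carrier G)" by simp
    fix u t k l
    assume u: "u \<in> unipotent_upper" "u \<noteq> \<one>\<^bsub>G\<^esub>"
      and t: "t \<in> carrier G" "k \<in> carrier G" "inv\<^bsub>G\<^esub> k \<otimes>\<^bsub>G\<^esub> t \<otimes>\<^bsub>G\<^esub> k \<in> unipotent_upper"
      and l: "l \<in> carrier G"
        "inv\<^bsub>G\<^esub> l \<otimes>\<^bsub>G\<^esub> (inv\<^bsub>G\<^esub> u \<otimes>\<^bsub>G\<^esub> t) \<otimes>\<^bsub>G\<^esub> l \<in> unipotent_upper"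
    \<comment> \<open>The parameter is taken from the inverse of \<open>u\<close>, because the trace
      condition concerns the product of that inverse with \<open>t\<close>.\<close>
    obtain x where x: "inv\<^bsub>G\<^esub> u = vector [vector [1, x], vector [0, 1]]"
      using U.m_inv_closed[OF u(1)] unfolding unipotent_upper_def by blast
    have "inv\<^bsub>G\<^esub> u \<noteq> \<one>\<^bsub>G\<^esub>"
      using u by (metis U.mem_carrier inv_inv inv_one)
    then have "x \<noteq> 0"
      using x unipotent_upper_one by (auto simp: one)
    moreover have "trace (inv\<^bsub>G\<^esub> u \<otimes>\<^bsub>G\<^esub> t) = 2"
      using trace_det(1)[OF _ l] u t by simp
    ultimately show "t \<in> unipotent_upper"
      using trace_det[OF t] unipotent_upper_if_trace[of x t] by (simp add: mult x)
  qed
qed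

end
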